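(* Let $n,p\in\mathbb R$ with $0<p<n$, let $\alpha\in(-1,1)$ and $N\in\mathbb N_0$. The differential operator $$\tilde D= \frac{d^2}{dx^2}(x^2-1)(x-\alpha)+\frac{d}{dx}\Big((n+3)x^2-\alpha(n+2)x-1+2(x-\alpha)\begin{pmatrix}0&1\\1&0\end{pmatrix}\Big)+\Big(-N(N+n+2)x+\alpha(n-2p)\begin{pmatrix}1&0\\0&0\end{pmatrix}+\begin{pmatrix}0&n-p+1\\ p+1&0\end{pmatrix}\Big),$$ acting from the right hand side, commutes with the integral operator $$(fS)(x)=\int_{-1}^\alpha f(y)W(y)\big(k(x,y)\big)^*dy,\qquad k(x,y)=\sum_{w=0}^NQ_w^*(x)Q_w(y),$$ where $\{Q_w\}_{w\ge0}$ are the matrix orthonormal polynomials with respect to $W=W_{p,n}$; that is, $(f\tilde D)S=(fS)\tilde D$ for all nice functions $f$.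
   Context: $W$ is the $2\times2$ matrix weight $$W(x)=W_{p,n}(x)=(1-x^2)^{\frac n2-1}\begin{pmatrix}p x^2+n-p&-nx\\-nx&(n-p)x^2+p\end{pmatrix},\qquad x\in[-1,1].$$ $\{R_w\}_{w\ge0}$ is the sequence of monic matrix orthogonal polynomials with respect to $W$: $R_w$ is a $2\times2$ matrix polynomial of degree $w$ with leading coefficient the identity and $\int_{-1}^1R_w(x)W(x)R_{v}^*(x)\,dx=0$ for $w\ne v$. Explicitly, $$R_w(x)=\frac{w!\,(n+1)}{2^w(\frac{n+1}2)_w}\begin{pmatrix}\frac1{n+1}C_w^{\frac{n+1}2}(x)+\frac1{p+w}C_{w-2}^{\frac{n+3}2}(x)&\frac1{p+w}C_{w-1}^{\frac{n+3}2}(x)\\ \frac1{n-p+w}C_{w-1}^{\frac{n+3}2}(x)&\frac1{n+1}C_w^{\frac{n+1}2}(x)+\frac1{n-p+w}C_{w-2}^{\frac{n+3}2}(x)\end{pmatrix},$$ where $C_j^\lambda$ is the $j$-th Gegenbauer polynomial ($C_j^\lambda=0$ for $j<0$) and $(a)_w$ is the Pochhammer symbol (rising factorial). The matrix $\|R_w\|^2=\int_{-1}^1R_w(x)W(x)R_w^*(x)\,dx$ is diagonal and positive definite, $\|R_w\|$ is its positive definite square root, and $Q_w=\|R_w\|^{-1}R_w$. "Nice functions" are the real $2\times2$ matrix valued functions that are $C^\infty$ on the closed interval $[-1,\alpha]$. A differential operator $\frac{d^2}{dx^2}F_2(x)+\frac{d}{dx}F_1(x)+F_0(x)$ acts from the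 right hand side: it sends $f$ to $f''(x)F_2(x)+f'(x)F_1(x)+f(x)F_0(x)$; scalars are understood as multiples of the identity matrix. $A^*$ denotes the (conjugate) transpose. *)

theory Defs
  imports "HOL-Analysis.Analysis"
begin

text \<open>All matrices are real, so the adjoint is \<^const>\<open>transpose\<close>.\<close>

type_synonym mat2 = "real^2^2"

definition matrix2 :: "real \<Rightarrow> real \<Rightarrow> real \<Rightarrow> real \<Rightarrow> mat2" where
  "matrix2 a b c d = vector [vector [a, b], vector [c, d]]"

text \<open>At \<open>x = 1\<close> and \<open>x = -1\<close> the formula gives \<open>0\<close>, because \<open>0 powr a = 0\<close> for every \<open>a\<close>.
  Where this differs from the intended value (or the weight is singular, for \<open>n < 2\<close>), it only
  concerns these two points, and \<open>W\<close> is only ever used under an integral.\<close>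

definition weight :: "real \<Rightarrow> real \<Rightarrow> real \<Rightarrow> mat2" where
  "weight p n x = ((1 - x\<^sup>2) powr (n / 2 - 1)) *\<^sub>R
     matrix2 (p * x\<^sup>2 + n - p) (- n * x)
             (- n * x)          ((n - p) * x\<^sup>2 + p)"

definition monic_matrix_poly :: "nat \<Rightarrow> (real \<Rightarrow> mat2) \<Rightarrow> bool" where
  "monic_matrix_poly w P \<longleftrightarrow>
     (\<exists>C :: nat \<Rightarrow> mat2. C w = mat 1 \<and> (\<forall>x. P x = (\<Sum>i\<le>w. x ^ i *\<^sub>R C i)))"

definition monic_orthogonal_polys :: "(real \<Rightarrow> mat2) \<Rightarrow> (nat \<Rightarrow> real \<Rightarrow> mat2) \<Rightarrow> bool" where
  "monic_orthogonal_polys W R \<longleftrightarrow>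
     (\<forall>w. monic_matrix_poly w (R w)) \<and>
     (\<forall>w v. w \<noteq> v \<longrightarrow> ((\<lambda>x. R w x ** W x ** transpose (R v x)) has_integral 0) {-1..1})"

definition sq_norm :: "(real \<Rightarrow> mat2) \<Rightarrow> (real \<Rightarrow> mat2) \<Rightarrow> mat2" where
  "sq_norm W P = integral {-1..1} (\<lambda>x. P x ** W x ** transpose (P x))"

definition positive_definite :: "mat2 \<Rightarrow> bool" where
  "positive_definite A \<longleftrightarrow> transpose A = A \<and> (\<forall>v. v \<noteq> 0 \<longrightarrow> 0 < v \<bullet> (A *v v))"

definition pd_sqrt :: "mat2 \<Rightarrow> mat2" where
  "pd_sqrt A = (THE B. positive_definite B \<and> B ** B = A)"

definition orthonormal_polys :: "(real \<Rightarrow> mat2) \<Rightarrow> (nat \<Rightarrow> real \<Rightarrow> mat2) \<Rightarrow> nat \<Rightarrow> real \<Rightarrow> mat2" where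
  "orthonormal_polys W R w x = matrix_inv (pd_sqrt (sq_norm W (R w))) ** R w x"

definition kernel :: "(nat \<Rightarrow> real \<Rightarrow> mat2) \<Rightarrow> nat \<Rightarrow> real \<Rightarrow> real \<Rightarrow> mat2" where
  "kernel Q N x y = (\<Sum>w\<le>N. transpose (Q w x) ** Q w y)"

definition integral_op ::
    "(real \<Rightarrow> mat2) \<Rightarrow> (nat \<Rightarrow> real \<Rightarrow> mat2) \<Rightarrow> real \<Rightarrow> nat \<Rightarrow> (real \<Rightarrow> mat2) \<Rightarrow> real \<Rightarrow> mat2" where
  "integral_op W Q \<alpha> N f x =
     integral {-1..\<alpha>} (\<lambda>y. f y ** W y ** transpose (kernel Q N x y))"

text \<open>Functions on the closed interval \<open>[a, b]\<close> are represented by functions on the whole line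
  whose values outside \<open>[a, b]\<close> are irrelevant: derivatives are taken within the interval, hence
  are one-sided at the end points.\<close>

definition deriv_on :: "real \<Rightarrow> real \<Rightarrow> (real \<Rightarrow> mat2) \<Rightarrow> real \<Rightarrow> mat2" where
  "deriv_on a b f x = vector_derivative f (at x within {a..b})"

definition smooth_on_interval :: "real \<Rightarrow> real \<Rightarrow> (real \<Rightarrow> mat2) \<Rightarrow> bool" where
  "smooth_on_interval a b f \<longleftrightarrow> (\<forall>k. ((deriv_on a b ^^ k) f) differentiable_on {a..b})"

text \<open>The operator with coefficients \<open>F2\<close>, \<open>F1\<close>, \<open>F0\<close> acting from the right hand side.\<close>

definition right_diff_op ::
    "real \<Rightarrow> real \<Rightarrow> (real \<Rightarrow> mat2) \<Rightarrow> (real \<Rightarrow> mat2) \<Rightarrow> (real \<Rightarrow> mat2) \<Rightarrow>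
     (real \<Rightarrow> mat2) \<Rightarrow> real \<Rightarrow> mat2" where
  "right_diff_op a b F2 F1 F0 f x =
     deriv_on a b (deriv_on a b f) x ** F2 x + deriv_on a b f x ** F1 x + f x ** F0 x"

definition D_tilde :: "real \<Rightarrow> real \<Rightarrow> real \<Rightarrow> nat \<Rightarrow> (real \<Rightarrow> mat2) \<Rightarrow> real \<Rightarrow> mat2" where
  "D_tilde p n \<alpha> N = right_diff_op (-1) \<alpha>
     (\<lambda>x. mat ((x\<^sup>2 - 1) * (x - \<alpha>)))
     (\<lambda>x. mat ((n + 3) * x\<^sup>2 - \<alpha> * (n + 2) * x - 1) + (2 * (x - \<alpha>)) *\<^sub>R matrix2 0 1 1 0)
     (\<lambda>x. mat (- (real N * (real N + n + 2) * x)) + (\<alpha> * (n - 2 * p)) *\<^sub>R matrix2 1 0 0 0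
          + matrix2 0 (n - p + 1) (p + 1) 0)"

end

theory Submission
  imports Defs
begin

text \<open>
  Let \<open>V\<close> be the space of matrix polynomials of degree at most \<open>N\<close> and write
  \<open>\<langle>f, g\<rangle>\<^sub>\<beta>\<close> for the integral of \<open>f W g\<^sup>*\<close> over \<open>[-1, \<beta>]\<close>. The kernel is the reproducing
  kernel of \<open>V\<close> for \<open>\<langle>_, _\<rangle>\<^sub>1\<close>, so the integral operator is truncation to \<open>[-1, \<alpha>]\<close> followed by
  orthogonal projection onto \<open>V\<close>: the function \<open>f S\<close> is the element of \<open>V\<close> with
  \<open>\<langle>f S, P\<rangle>\<^sub>1 = \<langle>f, P\<rangle>\<^sub>\<alpha>\<close> for all \<open>P\<close> in \<open>V\<close> (lemma \<open>integral_op_projection\<close>).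

  The differential operator \<open>D\<close> fits this description in two ways. It preserves \<open>V\<close>, because its
  zeroth order term cancels the coefficient of \<open>x\<^sup>N\<^sup>+\<^sup>1\<close> (lemma \<open>D_expr_polys\<close>). And it is symmetric
  both for \<open>\<langle>_, _\<rangle>\<^sub>\<alpha>\<close> and for \<open>\<langle>_, _\<rangle>\<^sub>1\<close> (lemma \<open>D_expr_symmetric\<close>): the symmetry equations with
  respect to \<open>W\<close> are pointwise identities, and all boundary terms contain the factor
  \<open>(x - \<alpha>) (1 - x\<^sup>2)\<^bsup>n/2\<^esup>\<close>, which vanishes at \<open>-1\<close>, at \<open>\<alpha>\<close> and at \<open>1\<close>. Hence, for all \<open>P\<close> in \<open>V\<close>,
  \<open>\<langle>(f D) S, P\<rangle>\<^sub>1 = \<langle>f D, P\<rangle>\<^sub>\<alpha> = \<langle>f, P D\<rangle>\<^sub>\<alpha> = \<langle>f S, P D\<rangle>\<^sub>1 = \<langle>(f S) D, P\<rangle>\<^sub>1\<close>,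
  and two elements of \<open>V\<close> with the same pairings are equal (lemma \<open>polys_determined\<close>).

  Since the \<open>R\<^sub>w\<close> are monic, \<open>R\<^sub>0, \<dots>, R\<^sub>N\<close> generate \<open>V\<close> as a module over the constant matrices, and it
  suffices to test with \<open>P = R\<^sub>v\<close>. The projection property needs that the matrices \<open>\<parallel>R\<^sub>w\<parallel>\<^sup>2\<close> are positive
  definite (lemma \<open>sq_norm_positive_definite\<close>), so that their square roots exist, are unique and are
  invertible.
\<close>

section \<open>Matrix algebra\<close>

lemma bounded_bilinear_matrix_mult:
  "bounded_bilinear ((**) :: real^'n^'m \<Rightarrow> real^'k^'n \<Rightarrow> real^'k^'m)"
  unfolding bilinear_conv_bounded_bilinear[symmetric] bilinear_def
  by (auto intro!: linearI simp: vec_eq_iff matrix_matrix_mult_def algebra_simps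
      sum.distrib sum_distrib_left)

interpretation matrix_mult: bounded_bilinear "(**) :: real^'n^'m \<Rightarrow> real^'k^'n \<Rightarrow> real^'k^'m"
  by (rule bounded_bilinear_matrix_mult)

lemma bounded_linear_transpose: "bounded_linear (transpose :: real^'n^'m \<Rightarrow> real^'m^'n)"
  unfolding linear_conv_bounded_linear[symmetric]
  by (auto intro!: linearI simp: vec_eq_iff transpose_def)

lemmas transpose_add = linear_add[OF bounded_linear.linear[OF bounded_linear_transpose]]
  and transpose_scaleR = linear_scale[OF bounded_linear.linear[OF bounded_linear_transpose]]
  and transpose_sum = linear_sum[OF bounded_linear.linear[OF bounded_linear_transpose]]

lemma mat2_eq_iff:
  fixes A B :: mat2
  shows "A = B \<longleftrightarrow> A$1$1 = B$1$1 \<and> A$1$2 = B$1$2 \<and> A$2$1 = B$2$1 \<and> A$2$2 = B$2$2"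
  by (auto simp: vec_eq_iff forall_2)

lemma matrix2_nth [simp]:
  "matrix2 a b c d $ 1 $ 1 = a" "matrix2 a b c d $ 1 $ 2 = b"
  "matrix2 a b c d $ 2 $ 1 = c" "matrix2 a b c d $ 2 $ 2 = d"
  by (simp_all add: matrix2_def)

lemma mat2_mult_nth [simp]:
  fixes A B :: mat2
  shows "(A ** B) $ i $ j = A$i$1 * B$1$j + A$i$2 * B$2$j"
  by (simp add: matrix_matrix_mult_def sum_2)

lemma mat2_mat_nth [simp]:
  "(mat c :: mat2)$1$1 = c" "(mat c :: mat2)$1$2 = 0" "(mat c :: mat2)$2$1 = 0" "(mat c :: mat2)$2$2 = c"
  by (simp_all add: mat_def)

lemma transpose_nth [simp]: "transpose A $ i $ j = A $ j $ i"
  by (simp add: transpose_def)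

section \<open>Positive definite matrices and their square roots\<close>

lemma quadratic_form_mat2:
  fixes A :: mat2
  shows "v \<bullet> (A *v v) = A$1$1 * (v$1)\<^sup>2 + (A$1$2 + A$2$1) * (v$1 * v$2) + A$2$2 * (v$2)\<^sup>2"
  by (simp add: inner_vec_def sum_2 matrix_vector_mult_def power2_eq_square algebra_simps)

text \<open>Sylvester's criterion, by completing the square.\<close>

lemma positive_definite_mat2_iff:
  "positive_definite A \<longleftrightarrow> A$1$2 = A$2$1 \<and> 0 < A$1$1 \<and> (A$1$2)\<^sup>2 < A$1$1 * A$2$2"
proof (intro iffI conjI)
  assume A: "positive_definite A"
  then have "transpose A $ 2 $ 1 = A $ 2 $ 1" by (simp add: positive_definite_def)
  then show s: "A$1$2 = A$2$1" by simp
  have pos: "v \<noteq> 0 \<Longrightarrow> 0 < v \<bullet> (A *v v)" for v using A by (auto simp: positive_definite_def)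
  have "vector [1, 0] \<noteq> (0::real^2)" by (simp add: vec_eq_iff forall_2)
  from pos[OF this] show a: "0 < A$1$1" by (simp add: quadratic_form_mat2)
  \<comment> \<open>On this vector, which is orthogonal to the first row, the form takes the value
    \<open>A$1$1 * det A\<close>.\<close>
  have "vector [A$1$2, - A$1$1] \<noteq> (0::real^2)" using a by (simp add: vec_eq_iff forall_2)
  from pos[OF this] have "0 < A$1$1 * (A$1$1 * A$2$2 - (A$1$2)\<^sup>2)"
    by (simp add: quadratic_form_mat2 s power2_eq_square algebra_simps)
  with a show "(A$1$2)\<^sup>2 < A$1$1 * A$2$2" by (simp add: zero_less_mult_iff)
next
  assume A: "A$1$2 = A$2$1 \<and> 0 < A$1$1 \<and> (A$1$2)\<^sup>2 < A$1$1 * A$2$2"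
  have "0 < v \<bullet> (A *v v)" if v: "v \<noteq> 0" for v
  proof -
    have "0 < (A$1$1 * v$1 + A$1$2 * v$2)\<^sup>2 + (A$1$1 * A$2$2 - (A$1$2)\<^sup>2) * (v$2)\<^sup>2"
    proof (cases "v$2 = 0")
      case True
      then show ?thesis using v A by (auto simp: vec_eq_iff forall_2)
    next
      case False
      then show ?thesis using A by (auto intro!: add_nonneg_pos mult_pos_pos)
    qed
    also have "\<dots> = A$1$1 * (v \<bullet> (A *v v))"
      using A by (simp add: quadratic_form_mat2 power2_eq_square algebra_simps)
    finally show ?thesis using A by (simp add: zero_less_mult_iff)
  qed
  with A show "positive_definite A"
    by (simp add: positive_definite_def mat2_eq_iff)
qed

lemma positive_definite_invertible:
  assumes "positive_definite A"
  shows "invertible A"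
  using assms by (auto simp: positive_definite_mat2_iff invertible_det_nz det_2 power2_eq_square)

text \<open>By Cayley-Hamilton \<open>B\<^sup>2 - (tr B) B + (det B) I = 0\<close>, so \<open>B\<close> is determined by \<open>A = B\<^sup>2\<close> and
  by its own trace and determinant; these are determined by \<open>A\<close> because
  \<open>(det B)\<^sup>2 = det A\<close> and \<open>(tr B)\<^sup>2 = tr A + 2 det B\<close>. The explicit formula gives the uniqueness of the
  square root, and read backwards its existence.\<close>

lemma positive_definite_square_root:
  fixes A B :: mat2
  assumes B: "positive_definite B" and BB: "B ** B = A"
  shows "B = (1 / sqrt (A$1$1 + A$2$2 + 2 * sqrt (det A))) *\<^sub>R (A + mat (sqrt (det A)))"
proof -
  have b: "B$2$1 = B$1$2" "0 < B$1$1" "B$1$2 * B$1$2 < B$1$1 * B$2$2"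
    using B by (auto simp: positive_definite_mat2_iff power2_eq_square)
  then have "0 < B$1$1 * B$2$2" by (meson le_less_trans zero_le_square)
  with b have "0 < B$2$2" by (simp add: zero_less_mult_iff)
  then have t: "0 < B$1$1 + B$2$2" using b by simp
  have d: "0 < det B" using b by (simp add: det_2)
  have "det A = (det B)\<^sup>2" by (simp add: BB[symmetric] det_mul power2_eq_square)
  with d have det: "det B = sqrt (det A)" by simp
  have "A$1$1 + A$2$2 + 2 * det B = (B$1$1 + B$2$2)\<^sup>2"
    by (simp add: BB[symmetric] det_2 b power2_eq_square algebra_simps)
  then have tr: "sqrt (A$1$1 + A$2$2 + 2 * sqrt (det A)) = B$1$1 + B$2$2"
    using t det by simp
  have "(B$1$1 + B$2$2) *\<^sub>R B = A + mat (det B)"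
    by (simp add: BB[symmetric] mat2_eq_iff det_2 b algebra_simps)
  then have "B = (1 / (B$1$1 + B$2$2)) *\<^sub>R (A + mat (det B))"
    using t by (subst (asm) eq_commute) simp
  then show ?thesis
    by (simp only: tr det)
qed

lemma positive_definite_square_root_exists:
  assumes A: "positive_definite A"
  shows "\<exists>B. positive_definite B \<and> B ** B = A"
proof -
  define s where "s = sqrt (det A)"
  define t where "t = sqrt (A$1$1 + A$2$2 + 2 * s)"
  have a: "A$2$1 = A$1$2" "0 < A$1$1" "A$1$2 * A$1$2 < A$1$1 * A$2$2"
    using A by (auto simp: positive_definite_mat2_iff power2_eq_square)
  then have "0 < A$1$1 * A$2$2" by (meson le_less_trans zero_le_square)
  with a have a2: "0 < A$2$2" by (simp add: zero_less_mult_iff)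
  have s: "0 < s" "s * s = A$1$1 * A$2$2 - A$1$2 * A$1$2" using a by (simp_all add: s_def det_2)
  have t: "0 < t" "t * t = A$1$1 + A$2$2 + 2 * s" using a a2 s by (simp_all add: t_def)
  define B :: mat2 where "B = (1/t) *\<^sub>R (A + mat s)"
  have "(A + mat s) ** (A + mat s) = (t * t) *\<^sub>R A"
    using s(2) by (simp add: mat2_eq_iff t(2) a(1) algebra_simps)
  then have "B ** B = A"
    using t(1) by (simp add: B_def matrix_mult.scaleR_left matrix_mult.scaleR_right)
  moreover have "positive_definite B"
  proof -
    have "A$1$2 * A$1$2 < (A$1$1 + s) * (A$2$2 + s)"
    proof -
      have "0 < s * s + s * A$1$1 + s * A$2$2" using a a2 s(1) by (intro add_pos_pos mult_pos_pos)
      with a show ?thesis by (simp add: algebra_simps)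
    qed
    then have "A$1$2 * A$1$2 / (t * t) < (A$1$1 + s) * (A$2$2 + s) / (t * t)"
      using t(1) by (simp add: divide_strict_right_mono)
    then show ?thesis using a t(1) s(1) by (simp add: positive_definite_mat2_iff B_def power2_eq_square)
  qed
  ultimately show ?thesis by blast
qed

lemma pd_sqrt:
  assumes "positive_definite A"
  shows "positive_definite (pd_sqrt A)" "pd_sqrt A ** pd_sqrt A = A"
proof -
  have "\<exists>!B. positive_definite B \<and> B ** B = A"
    using positive_definite_square_root_exists[OF assms] positive_definite_square_root by metis
  from theI'[OF this] show "positive_definite (pd_sqrt A)" "pd_sqrt A ** pd_sqrt A = A"
    by (simp_all add: pd_sqrt_def)
qed

text \<open>The normalisation \<open>Q\<^sub>w = C R\<^sub>w\<close> with \<open>C\<close> the inverse of the square root of \<open>A = \<parallel>R\<^sub>w\<parallel>\<^sup>2\<close> enters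
  the kernel only through \<open>C\<^sup>* C\<close>, which is the inverse of \<open>A\<close>.\<close>

lemma inverse_pd_sqrt:
  assumes "positive_definite A"
  defines "C \<equiv> matrix_inv (pd_sqrt A)"
  shows "(transpose C ** C) ** A = mat 1"
proof -
  let ?L = "pd_sqrt A"
  have inv: "C ** ?L = mat 1" "?L ** C = mat 1"
    using positive_definite_invertible[OF pd_sqrt(1)[OF assms(1)]]
    unfolding invertible_def C_def matrix_inv_def by (metis (mono_tags, lifting) someI_ex)+
  have "transpose C ** ?L = transpose (transpose ?L ** C)" by (simp add: matrix_transpose_mul)
  also have "transpose ?L = ?L" using pd_sqrt(1)[OF assms(1)] by (simp add: positive_definite_def)
  finally have "transpose C ** ?L = mat 1" by (simp add: inv)
  moreover have "(transpose C ** C) ** A = transpose C ** (C ** ?L) ** ?L"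
    by (subst pd_sqrt(2)[OF assms(1), symmetric]) (simp only: matrix_mul_assoc)
  ultimately show ?thesis by (simp add: inv)
qed

section \<open>Matrix polynomials of bounded degree\<close>

definition matrix_polys :: "nat \<Rightarrow> (real \<Rightarrow> mat2) set" where
  "matrix_polys N = {P. \<exists>C. \<forall>x. P x = (\<Sum>i\<le>N. x ^ i *\<^sub>R C i)}"

lemma matrix_polysI: "(\<And>x. P x = (\<Sum>i\<le>N. x ^ i *\<^sub>R C i)) \<Longrightarrow> P \<in> matrix_polys N"
  unfolding matrix_polys_def by blast

lemma matrix_polys_add:
  assumes "P \<in> matrix_polys N" "Q \<in> matrix_polys N"
  shows "(\<lambda>x. P x + Q x) \<in> matrix_polys N"
proof -
  obtain C E where "\<forall>x. P x = (\<Sum>i\<le>N. x ^ i *\<^sub>R C i)" "\<forall>x. Q x = (\<Sum>i\<le>N. x ^ i *\<^sub>R E i)"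
    using assms unfolding matrix_polys_def by blast
  then show ?thesis
    by (intro matrix_polysI[where C = "\<lambda>i. C i + E i"]) (simp add: scaleR_add_right sum.distrib)
qed

lemma matrix_polys_lmult:
  assumes "P \<in> matrix_polys N"
  shows "(\<lambda>x. A ** P x) \<in> matrix_polys N"
proof -
  obtain C where "\<forall>x. P x = (\<Sum>i\<le>N. x ^ i *\<^sub>R C i)"
    using assms unfolding matrix_polys_def by blast
  then show ?thesis
    by (intro matrix_polysI[where C = "\<lambda>i. A ** C i"])
      (simp add: matrix_mult.sum_right matrix_mult.scaleR_right)
qed

lemma matrix_polys_diff:
  assumes "P \<in> matrix_polys N" "Q \<in> matrix_polys N"
  shows "(\<lambda>x. P x - Q x) \<in> matrix_polys N"
  using matrix_polys_add[OF assms(1) matrix_polys_lmult[OF assms(2), of "- mat 1"]]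
  by (simp add: matrix_mult.minus_left)

lemma matrix_polys_monomial:
  assumes "i \<le> N"
  shows "(\<lambda>x. x ^ i *\<^sub>R A) \<in> matrix_polys N"
proof (rule matrix_polysI[where C = "\<lambda>j. if j = i then A else 0"])
  show "x ^ i *\<^sub>R A = (\<Sum>j\<le>N. x ^ j *\<^sub>R (if j = i then A else 0))" for x :: real
    using assms by (simp add: if_distrib[where f = "scaleR _"] sum.delta cong: if_cong)
qed

lemma matrix_polys_zero: "(\<lambda>x. 0) \<in> matrix_polys N"
  using matrix_polys_monomial[of 0 N 0] by simp

lemma matrix_polys_sum:
  assumes "\<And>w. w \<in> I \<Longrightarrow> P w \<in> matrix_polys N"
  shows "(\<lambda>x. \<Sum>w\<in>I. P w x) \<in> matrix_polys N"
  using assms by (induction I rule: infinite_finite_induct)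
    (auto intro: matrix_polys_zero matrix_polys_add)

lemma matrix_polys_mono:
  assumes "P \<in> matrix_polys M" "M \<le> N"
  shows "P \<in> matrix_polys N"
proof -
  obtain C where "\<forall>x. P x = (\<Sum>i\<le>M. x ^ i *\<^sub>R C i)"
    using assms unfolding matrix_polys_def by blast
  then have "P = (\<lambda>x. \<Sum>i\<le>M. x ^ i *\<^sub>R C i)" by auto
  moreover have "(\<lambda>x. \<Sum>i\<le>M. x ^ i *\<^sub>R C i) \<in> matrix_polys N"
    using assms(2) by (intro matrix_polys_sum matrix_polys_monomial) auto
  ultimately show ?thesis by simp
qed

lemma continuous_on_matrix_polys:
  assumes "P \<in> matrix_polys N"
  shows "continuous_on A P"
proof -
  obtain C where "\<forall>x. P x = (\<Sum>i\<le>N. x ^ i *\<^sub>R C i)"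
    using assms unfolding matrix_polys_def by blast
  then have "P = (\<lambda>x. \<Sum>i\<le>N. x ^ i *\<^sub>R C i)" by auto
  then show ?thesis by (simp add: continuous_intros)
qed

lemma monic_matrix_poly_in_polys:
  assumes "monic_matrix_poly w P"
  shows "P \<in> matrix_polys w"
  using assms by (auto simp: monic_matrix_poly_def intro: matrix_polysI)

text \<open>Subtracting \<open>C R\<^sub>N\<close>, with \<open>C\<close> the leading coefficient of \<open>P\<close>, lowers the degree because \<open>R\<^sub>N\<close> is
  monic.\<close>

lemma expansion_in_monic_polys:
  assumes R: "\<And>w. monic_matrix_poly w (R w)" and P: "P \<in> matrix_polys N"
  shows "\<exists>A. \<forall>x. P x = (\<Sum>w\<le>N. A w ** R w x)"
  using P
proof (induction N arbitrary: P)
  case 0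
  then obtain C where "\<forall>x. P x = C (0::nat)" by (auto simp: matrix_polys_def)
  moreover have "\<forall>x. R 0 x = mat 1" using R[of 0] by (auto simp: monic_matrix_poly_def)
  ultimately show ?case by (auto intro!: exI[of _ "\<lambda>_. C 0"])
next
  case (Suc N)
  then obtain C where C: "\<forall>x. P x = (\<Sum>i\<le>Suc N. x ^ i *\<^sub>R C i)" by (auto simp: matrix_polys_def)
  obtain E where E: "E (Suc N) = mat 1" "\<forall>x. R (Suc N) x = (\<Sum>i\<le>Suc N. x ^ i *\<^sub>R E i)"
    using R[of "Suc N"] by (auto simp: monic_matrix_poly_def)
  have "(\<lambda>x. P x - C (Suc N) ** R (Suc N) x) \<in> matrix_polys N"
    by (rule matrix_polysI[where C = "\<lambda>i. C i - C (Suc N) ** E i"])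
      (simp add: C E matrix_mult.add_right matrix_mult.sum_right matrix_mult.scaleR_right
        scaleR_diff_right sum_subtractf)
  from Suc.IH[OF this] obtain A
    where A: "\<forall>x. P x - C (Suc N) ** R (Suc N) x = (\<Sum>w\<le>N. A w ** R w x)" by blast
  show ?case
  proof (intro exI[of _ "A(Suc N := C (Suc N))"] allI)
    fix x
    have "P x = (\<Sum>w\<le>N. A w ** R w x) + C (Suc N) ** R (Suc N) x"
      by (metis A diff_add_cancel)
    then show "P x = (\<Sum>w\<le>Suc N. (A(Suc N := C (Suc N))) w ** R w x)" by simp
  qed
qed

text \<open>The scalar polynomial \<open>v\<^sup>* P(x)\<^sup>* v\<close> has leading coefficient \<open>v\<^sup>* v \<noteq> 0\<close>, so it has only finitely
  many zeros.\<close>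

lemma monic_poly_not_annihilating:
  assumes P: "monic_matrix_poly w P" and v: "v \<noteq> 0" and ab: "a < b"
  shows "\<exists>x\<in>{a..b}. transpose (P x) *v v \<noteq> 0"
proof (rule ccontr)
  assume "\<not> ?thesis"
  then have zero: "v \<bullet> (transpose (P x) *v v) = 0" if "x \<in> {a..b}" for x using that by auto
  obtain C where C: "C w = mat 1" "\<And>x. P x = (\<Sum>i\<le>w. x ^ i *\<^sub>R C i)"
    using P by (auto simp: monic_matrix_poly_def)
  define c where "c i = v \<bullet> (transpose (C i) *v v)" for i
  have "v \<bullet> (transpose (P x) *v v) = (\<Sum>i\<le>w. c i * x ^ i)" for x
    unfolding c_def quadratic_form_mat2 C(2)
    by (simp add: sum_component sum_distrib_right sum_distrib_left sum.distrib algebra_simps)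
  with zero have "{a..b} \<subseteq> {x. (\<Sum>i\<le>w. c i * x ^ i) = 0}" by auto
  moreover have "c w \<noteq> 0" using v by (simp add: c_def C(1))
  then have "finite {x. (\<Sum>i\<le>w. c i * x ^ i) = 0}"
    using polyfun_finite_roots[of c w] by auto
  ultimately show False using ab by (meson finite_subset infinite_Icc)
qed

section \<open>The differential operator preserves polynomials of degree at most N\<close>

definition D_coeff1 :: "real \<Rightarrow> real \<Rightarrow> real \<Rightarrow> mat2" where
  "D_coeff1 n \<alpha> x =
     mat ((n + 3) * x\<^sup>2 - \<alpha> * (n + 2) * x - 1) + (2 * (x - \<alpha>)) *\<^sub>R matrix2 0 1 1 0"

definition D_coeff0 :: "real \<Rightarrow> real \<Rightarrow> real \<Rightarrow> nat \<Rightarrow> real \<Rightarrow> mat2" where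
  "D_coeff0 p n \<alpha> N x =
     mat (- (real N * (real N + n + 2) * x)) + (\<alpha> * (n - 2 * p)) *\<^sub>R matrix2 1 0 0 0
     + matrix2 0 (n - p + 1) (p + 1) 0"

text \<open>The operator applied to a function whose first two derivatives are supplied separately, so
  that the same expression serves on \<open>[-1, \<alpha>]\<close>, on \<open>[-1, 1]\<close> and for polynomials on the whole line.\<close>

definition D_expr ::
  "real \<Rightarrow> real \<Rightarrow> real \<Rightarrow> nat \<Rightarrow> (real \<Rightarrow> mat2) \<Rightarrow> (real \<Rightarrow> mat2) \<Rightarrow> (real \<Rightarrow> mat2) \<Rightarrow> real \<Rightarrow> mat2" where
  "D_expr p n \<alpha> N f f' f'' x =
     f'' x ** mat ((x\<^sup>2 - 1) * (x - \<alpha>)) + f' x ** D_coeff1 n \<alpha> x + f x ** D_coeff0 p n \<alpha> N x"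

lemma mat_eq_scaleR: "(mat c :: real^'n^'n) = c *\<^sub>R mat 1"
  by (simp add: vec_eq_iff mat_def)

lemma continuous_on_D_expr:
  assumes "continuous_on A f" "continuous_on A f'" "continuous_on A f''"
  shows "continuous_on A (D_expr p n \<alpha> N f f' f'')"
  unfolding D_expr_def[abs_def] D_coeff1_def D_coeff0_def mat_eq_scaleR[of "_ * _"]
    mat_eq_scaleR[of "- _"] mat_eq_scaleR[of "_ - _"]
  by (intro matrix_mult.continuous_on continuous_intros assms)

lemma D_tilde_eq:
  "D_tilde p n \<alpha> N f =
     D_expr p n \<alpha> N f (deriv_on (-1) \<alpha> f) (deriv_on (-1) \<alpha> (deriv_on (-1) \<alpha> f))"
  by (auto simp: D_tilde_def right_diff_op_def D_expr_def D_coeff1_def D_coeff0_def)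

text \<open>The operator raises degrees by at most one, and it maps \<open>x\<^sup>i A\<close> to \<open>x\<^sup>i\<^sup>+\<^sup>1 c A\<close> plus terms of degree
  at most \<open>i\<close>, where \<open>c = i (i + n + 2) - N (N + n + 2)\<close>. The term \<open>-N (N + n + 2) x\<close> of the operator
  is there to make \<open>c\<close> vanish at \<open>i = N\<close>, the only case in which the degree could exceed \<open>N\<close>.\<close>

lemma D_expr_monomial:
  assumes "i \<le> N"
  shows "D_expr p n \<alpha> N (\<lambda>x. x ^ i *\<^sub>R A) (\<lambda>x. (real i * x ^ (i - 1)) *\<^sub>R A)
           (\<lambda>x. (real i * (real (i - 1) * x ^ (i - 1 - 1))) *\<^sub>R A) \<in> matrix_polys N"
    (is "?P \<in> _")
proof -
  define J :: mat2 where "J = matrix2 0 1 1 0"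
  define F :: mat2 where "F = (\<alpha> * (n - 2 * p)) *\<^sub>R matrix2 1 0 0 0 + matrix2 0 (n - p + 1) (p + 1) 0"
  let ?r = "real i"
  define E0 where "E0 = (- \<alpha> * ?r * (?r + n + 1)) *\<^sub>R A + (2 * ?r) *\<^sub>R (A ** J) + A ** F"
  define E1 where "E1 = (- ?r * ?r) *\<^sub>R A - (2 * ?r * \<alpha>) *\<^sub>R (A ** J)"
  define E2 where "E2 = (\<alpha> * (?r * (?r - 1))) *\<^sub>R A"
  define c where "c = ?r * (?r + n + 2) - real N * (real N + n + 2)"
  have "?P x = x ^ Suc i *\<^sub>R (c *\<^sub>R A) + x ^ i *\<^sub>R E0 + x ^ (i - 1) *\<^sub>R E1 + x ^ (i - 2) *\<^sub>R E2" for x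
  proof -
    have "?P x = (?r * (real (i - 1) * x ^ (i - 1 - 1)) * ((x\<^sup>2 - 1) * (x - \<alpha>))
        + ?r * x ^ (i - 1) * ((n + 3) * x\<^sup>2 - \<alpha> * (n + 2) * x - 1)
        - x ^ i * (real N * (real N + n + 2) * x)) *\<^sub>R A
      + (?r * x ^ (i - 1) * (2 * (x - \<alpha>))) *\<^sub>R (A ** J) + x ^ i *\<^sub>R (A ** F)"
      by (simp add: mat2_eq_iff D_expr_def D_coeff1_def D_coeff0_def J_def F_def algebra_simps)
    also have "\<dots> = x ^ Suc i *\<^sub>R (c *\<^sub>R A) + x ^ i *\<^sub>R E0 + x ^ (i - 1) *\<^sub>R E1 + x ^ (i - 2) *\<^sub>R E2"
    proof -
      \<comment> \<open>The exponents \<open>i - 1\<close> and \<open>i - 2\<close> are truncated for \<open>i < 2\<close>; there the coefficients vanish.\<close>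
      consider "i = 0" | "i = 1" | j where "i = Suc (Suc j)"
        by (metis One_nat_def not0_implies_Suc)
      then show ?thesis
        by cases (simp_all add: E0_def E1_def E2_def c_def mat2_eq_iff algebra_simps power2_eq_square)
    qed
    finally show ?thesis .
  qed
  then have eq: "?P = (\<lambda>x. x ^ Suc i *\<^sub>R (c *\<^sub>R A) + x ^ i *\<^sub>R E0 + x ^ (i - 1) *\<^sub>R E1 + x ^ (i - 2) *\<^sub>R E2)" by blast
  have top: "(\<lambda>x. x ^ Suc i *\<^sub>R (c *\<^sub>R A)) \<in> matrix_polys N"
  proof (cases "i = N")
    case True
    then show ?thesis by (simp add: c_def matrix_polys_zero)
  next
    case False
    then show ?thesis using assms by (intro matrix_polys_monomial) simp
  qed
  show ?thesis
    unfolding eq using assms by (intro matrix_polys_add matrix_polys_monomial top) auto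
qed

lemma D_expr_polys:
  assumes "P \<in> matrix_polys N"
  obtains P' P'' where
    "\<And>x. (P has_vector_derivative P' x) (at x)"
    "\<And>x. (P' has_vector_derivative P'' x) (at x)"
    "\<And>A. continuous_on A P''"
    "D_expr p n \<alpha> N P P' P'' \<in> matrix_polys N"
proof -
  obtain C where "\<forall>x. P x = (\<Sum>i\<le>N. x ^ i *\<^sub>R C i)"
    using assms unfolding matrix_polys_def by blast
  then have P: "P = (\<lambda>x. \<Sum>i\<le>N. x ^ i *\<^sub>R C i)" by auto
  let ?P' = "\<lambda>x. \<Sum>i\<le>N. (real i * x ^ (i - 1)) *\<^sub>R C i"
  let ?P'' = "\<lambda>x. \<Sum>i\<le>N. (real i * (real (i - 1) * x ^ (i - 1 - 1))) *\<^sub>R C i"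
  have d1: "(P has_vector_derivative ?P' x) (at x)" for x
    unfolding P by (auto intro!: derivative_eq_intros)
  have d2: "(?P' has_vector_derivative ?P'' x) (at x)" for x
    by (auto intro!: derivative_eq_intros simp: mult_ac)
  have co: "continuous_on A ?P''" for A
    by (intro continuous_intros)
  have "D_expr p n \<alpha> N P ?P' ?P'' =
      (\<lambda>x. \<Sum>i\<le>N. D_expr p n \<alpha> N (\<lambda>x. x ^ i *\<^sub>R C i) (\<lambda>x. (real i * x ^ (i - 1)) *\<^sub>R C i)
           (\<lambda>x. (real i * (real (i - 1) * x ^ (i - 1 - 1))) *\<^sub>R C i) x)"
    by (intro ext) (simp only: D_expr_def P matrix_mult.sum_left sum.distrib)
  also have "\<dots> \<in> matrix_polys N"
    by (intro matrix_polys_sum D_expr_monomial) simp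
  finally show thesis
    using d1 d2 co by (rule that[rotated -1])
qed

section \<open>The weight and the matrix valued pairing\<close>

definition weight_scalar :: "real \<Rightarrow> real \<Rightarrow> real" where
  "weight_scalar n x = (1 - x\<^sup>2) powr (n / 2 - 1)"

definition weight_matrix :: "real \<Rightarrow> real \<Rightarrow> real \<Rightarrow> mat2" where
  "weight_matrix p n x = matrix2 (p * x\<^sup>2 + n - p) (- n * x) (- n * x) ((n - p) * x\<^sup>2 + p)"

lemma weight_eq: "weight p n x = weight_scalar n x *\<^sub>R weight_matrix p n x"
  by (simp add: weight_def weight_scalar_def weight_matrix_def)

lemma weight_matrix_eq:
  "weight_matrix p n = (\<lambda>x. x\<^sup>2 *\<^sub>R matrix2 p 0 0 (n - p) + x *\<^sub>R matrix2 0 (- n) (- n) 0 + matrix2 (n - p) 0 0 p)"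
  by (auto simp: weight_matrix_def mat2_eq_iff)

lemma transpose_weight_matrix: "transpose (weight_matrix p n x) = weight_matrix p n x"
  by (simp add: weight_matrix_def mat2_eq_iff)

text \<open>The determinant of the matrix part is \<open>p (n - p) (1 - x\<^sup>2)\<^sup>2\<close>.\<close>

lemma weight_matrix_positive_definite:
  assumes "0 < p" "p < n" "\<bar>x\<bar> < 1"
  shows "positive_definite (weight_matrix p n x)"
proof -
  have "x\<^sup>2 < 1" using assms(3) by (simp add: abs_square_less_1)
  then have "0 < p * (n - p) * (1 - x\<^sup>2)\<^sup>2" using assms by simp
  also have "\<dots> = (p * x\<^sup>2 + n - p) * ((n - p) * x\<^sup>2 + p) - (- n * x)\<^sup>2"
    by (simp add: algebra_simps power2_eq_square)
  finally have "(- n * x)\<^sup>2 < (p * x\<^sup>2 + n - p) * ((n - p) * x\<^sup>2 + p)" by simp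
  moreover have "0 < p * x\<^sup>2 + (n - p)" using assms by (intro add_nonneg_pos) auto
  ultimately show ?thesis
    by (simp add: positive_definite_mat2_iff weight_matrix_def algebra_simps)
qed

text \<open>For \<open>n < 2\<close> the scalar factor is unbounded near \<open>x = -1\<close> and \<open>x = 1\<close>. The substitution
  \<open>x = 2 t - 1\<close> turns its integral into a Beta integral with both parameters \<open>n / 2 > 0\<close>.\<close>

lemma weight_scalar_integrable:
  assumes "0 < n"
  shows "weight_scalar n absolutely_integrable_on {-1..1}"
proof -
  let ?a = "n / 2 - 1"
  have "((\<lambda>t. t powr ?a * (1 - t) powr ?a) has_integral Beta (n/2) (n/2)) (cbox 0 1)"
    using has_integral_Beta_real[of "n/2" "n/2"] assms by simp
  from has_integral_affinity[OF this, of "1/2" "1/2"]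
  have "(\<lambda>x. ((x + 1) / 2) powr ?a * (1 - (x + 1) / 2) powr ?a) integrable_on ((\<lambda>x. 2 * x - 1) ` {0..1})"
    by (auto simp: add_divide_distrib intro: has_integral_integrable)
  moreover have "(\<lambda>x. 2 * x - 1) ` {0..1} = {-1..1::real}"
    using image_affinity_atLeastAtMost_diff[of 2 1 0 "1::real"] by simp
  ultimately have "(\<lambda>x. ((x + 1) / 2) powr ?a * (1 - (x + 1) / 2) powr ?a) integrable_on {-1..1}"
    by simp
  then have "(\<lambda>x. 4 powr ?a * (((x + 1) / 2) powr ?a * (1 - (x + 1) / 2) powr ?a)) integrable_on {-1..1}"
    by (rule integrable_on_mult_right)
  moreover have "4 powr ?a * (((x + 1) / 2) powr ?a * (1 - (x + 1) / 2) powr ?a) = weight_scalar n x"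
    if "x \<in> {-1..1}" for x
  proof -
    have "4 powr ?a * (s powr ?a * (1 - s) powr ?a) = (4 * (s * (1 - s))) powr ?a"
      if "0 \<le> s" "s \<le> 1" for s :: real
      using that by (simp add: powr_mult)
    from this[of "(x + 1) / 2"] that
    have "4 powr ?a * (((x + 1) / 2) powr ?a * (1 - (x + 1) / 2) powr ?a)
        = (4 * (((x + 1) / 2) * (1 - (x + 1) / 2))) powr ?a"
      by simp
    also have "4 * (((x + 1) / 2) * (1 - (x + 1) / 2)) = 1 - x\<^sup>2"
      by (simp add: field_simps power2_eq_square)
    finally show ?thesis by (simp add: weight_scalar_def)
  qed
  ultimately have "weight_scalar n integrable_on {-1..1}"
    by (rule integrable_eq)
  then show ?thesis
    by (intro nonnegative_absolutely_integrable_1) (auto simp: weight_scalar_def)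
qed

text \<open>The matrix valued inner product \<open>\<langle>f, g\<rangle>\<close> over \<open>[-1, \<beta>]\<close>. It is used for \<open>\<beta> = \<alpha>\<close>, where the
  integral operator lives, and for \<open>\<beta> = 1\<close>, where the polynomials are orthogonal.\<close>

definition pairing :: "real \<Rightarrow> real \<Rightarrow> real \<Rightarrow> (real \<Rightarrow> mat2) \<Rightarrow> (real \<Rightarrow> mat2) \<Rightarrow> mat2" where
  "pairing p n \<beta> f g = integral {-1..\<beta>} (\<lambda>x. f x ** weight p n x ** transpose (g x))"

lemma pairing_integrable:
  fixes f g :: "real \<Rightarrow> mat2"
  assumes "0 < n" "\<beta> \<le> 1" "continuous_on {-1..\<beta>} f" "continuous_on {-1..\<beta>} g"
  shows "(\<lambda>x. f x ** weight p n x ** transpose (g x)) integrable_on {-1..\<beta>}"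
proof -
  let ?F = "\<lambda>x. f x ** weight_matrix p n x ** transpose (g x)"
  have "continuous_on {-1..\<beta>} ?F"
    unfolding weight_matrix_eq
    by (intro matrix_mult.continuous_on bounded_linear.continuous_on[OF bounded_linear_transpose]
        continuous_intros assms)
  then have meas: "?F \<in> borel_measurable (lebesgue_on {-1..\<beta>})" and bdd: "bounded (?F ` {-1..\<beta>})"
    by (auto intro: continuous_imp_measurable_on_sets_lebesgue compact_imp_bounded compact_continuous_image)
  have int: "weight_scalar n absolutely_integrable_on {-1..\<beta>}"
    using assms(2) by (intro set_integrable_subset[OF weight_scalar_integrable[OF assms(1)]]) auto
  have bil: "bilinear (\<lambda>(A :: mat2) (r :: real). r *\<^sub>R A)"
    by (auto simp: bilinear_def algebra_simps intro!: linearI)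
  have "(\<lambda>x. weight_scalar n x *\<^sub>R ?F x) absolutely_integrable_on {-1..\<beta>}"
    by (rule absolutely_integrable_bounded_measurable_product
        [where h = "\<lambda>A r. r *\<^sub>R A" and f = ?F and g = "weight_scalar n"])
      (use bil meas bdd int in simp_all)
  then show ?thesis
    by (simp add: weight_eq matrix_mult.scaleR_left matrix_mult.scaleR_right
        absolutely_integrable_on_def)
qed

lemma pairing_lmult:
  assumes "0 < n" "\<beta> \<le> 1" "continuous_on {-1..\<beta>} f" "continuous_on {-1..\<beta>} g"
  shows "pairing p n \<beta> (\<lambda>x. A ** f x) g = A ** pairing p n \<beta> f g"
  using integral_linear[OF pairing_integrable[OF assms, of p] matrix_mult.bounded_linear_right, of A]
  by (simp add: pairing_def o_def matrix_mul_assoc)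

lemma pairing_rmult:
  assumes "0 < n" "\<beta> \<le> 1" "continuous_on {-1..\<beta>} f" "continuous_on {-1..\<beta>} g"
  shows "pairing p n \<beta> f (\<lambda>x. A ** g x) = pairing p n \<beta> f g ** transpose A"
  using integral_linear[OF pairing_integrable[OF assms, of p] matrix_mult.bounded_linear_left, of "transpose A"]
  by (simp add: pairing_def o_def matrix_mul_assoc matrix_transpose_mul)

lemma pairing_sum_left:
  assumes "0 < n" "\<beta> \<le> 1" "finite I"
    "\<And>i. i \<in> I \<Longrightarrow> continuous_on {-1..\<beta>} (f i)" "continuous_on {-1..\<beta>} g"
  shows "pairing p n \<beta> (\<lambda>x. \<Sum>i\<in>I. f i x) g = (\<Sum>i\<in>I. pairing p n \<beta> (f i) g)"
  unfolding pairing_def matrix_mult.sum_left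
  using assms by (intro integral_sum pairing_integrable) auto

lemma pairing_sum_right:
  assumes "0 < n" "\<beta> \<le> 1" "finite I"
    "\<And>i. i \<in> I \<Longrightarrow> continuous_on {-1..\<beta>} (g i)" "continuous_on {-1..\<beta>} f"
  shows "pairing p n \<beta> f (\<lambda>x. \<Sum>i\<in>I. g i x) = (\<Sum>i\<in>I. pairing p n \<beta> f (g i))"
  unfolding pairing_def transpose_sum matrix_mult.sum_right
  using assms by (intro integral_sum pairing_integrable) auto

lemma pairing_diff_left:
  assumes "0 < n" "\<beta> \<le> 1"
    "continuous_on {-1..\<beta>} f" "continuous_on {-1..\<beta>} h" "continuous_on {-1..\<beta>} g"
  shows "pairing p n \<beta> (\<lambda>x. f x - h x) g = pairing p n \<beta> f g - pairing p n \<beta> h g"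
  unfolding pairing_def matrix_mult.diff_left
  using assms by (intro integral_diff pairing_integrable) auto

text \<open>The quadratic form of \<open>\<parallel>P\<parallel>\<^sup>2\<close> at \<open>v\<close> is the integral of \<open>u\<^sup>* W u \<ge> 0\<close> with \<open>u = P\<^sup>* v\<close>. It can vanish
  only if \<open>u\<close> vanishes identically on \<open>(-1, 1)\<close>, which is impossible for monic \<open>P\<close> and \<open>v \<noteq> 0\<close>.\<close>

lemma sq_norm_positive_definite:
  assumes pn: "0 < p" "p < n" and P: "monic_matrix_poly w P"
  shows "positive_definite (sq_norm (weight p n) P)"
proof -
  let ?G = "\<lambda>x. P x ** weight p n x ** transpose (P x)"
  have cont: "continuous_on A P" for A
    using continuous_on_matrix_polys[OF monic_matrix_poly_in_polys[OF P]] .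
  have G: "?G integrable_on {-1..1}"
    using pn by (intro pairing_integrable cont) auto
  have "transpose (integral {-1..1} ?G) = integral {-1..1} (\<lambda>x. transpose (?G x))"
    using integral_linear[OF G bounded_linear_transpose] by (simp add: o_def)
  also have "(\<lambda>x. transpose (?G x)) = ?G"
    by (simp add: matrix_transpose_mul matrix_mul_assoc weight_eq transpose_scaleR transpose_weight_matrix)
  finally have sym: "transpose (sq_norm (weight p n) P) = sq_norm (weight p n) P"
    by (simp add: sq_norm_def)
  have "0 < v \<bullet> (sq_norm (weight p n) P *v v)" if v: "v \<noteq> 0" for v
  proof -
    define q where "q x = v \<bullet> (?G x *v v)" for x
    have lin: "bounded_linear (\<lambda>A :: mat2. v \<bullet> (A *v v))"
      unfolding linear_conv_bounded_linear[symmetric]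
      by (auto intro!: linearI simp: quadratic_form_mat2 algebra_simps)
    have q: "q integrable_on {-1..1}" "v \<bullet> (sq_norm (weight p n) P *v v) = integral {-1..1} q"
      using integrable_linear[OF G lin] integral_linear[OF G lin]
      by (simp_all add: o_def q_def[abs_def] sq_norm_def)
    let ?u = "\<lambda>x. transpose (P x) *v v"
    have q_eq: "q x = weight_scalar n x * (?u x \<bullet> (weight_matrix p n x *v ?u x))" for x
      by (simp add: q_def weight_eq matrix_mult.scaleR_left matrix_mult.scaleR_right
          scaleR_matrix_vector_assoc[symmetric] matrix_vector_mul_assoc[symmetric] dot_lmul_matrix)
    have wpos: "0 < weight_scalar n x" if "\<bar>x\<bar> < 1" for x
      using that by (auto simp: weight_scalar_def power2_eq_1_iff)
    have q_nonneg: "0 \<le> q x" if "x \<in> {-1..1}" for x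
    proof (cases "\<bar>x\<bar> < 1")
      case True
      then show ?thesis
        using weight_matrix_positive_definite[OF pn True] wpos[OF True]
        by (cases "?u x = 0") (auto simp: q_eq positive_definite_def less_imp_le)
    next
      case False
      then have "x = 1 \<or> x = -1" using that by auto
      then show ?thesis by (auto simp: q_eq weight_scalar_def)
    qed
    \<comment> \<open>Any interval inside \<open>(-1, 1)\<close> would do: there the weight is continuous even when it is singular
      at the end points.\<close>
    obtain z where z: "z \<in> {-1/2..1/2}" "?u z \<noteq> 0"
      using monic_poly_not_annihilating[OF P v, of "-1/2" "1/2"] by auto
    then have "0 < q z"
      using weight_matrix_positive_definite[OF pn, of z] wpos[of z]
      by (auto simp: q_eq positive_definite_def)
    moreover have "q z = 0" if "integral {-1..1} q = 0"
    proof (rule has_integral_0_cbox_imp_0[of "-1/2" "1/2" q])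
      have "continuous_on {-1/2..1/2} (\<lambda>x. weight_scalar n x *\<^sub>R (P x ** weight_matrix p n x ** transpose (P x)))"
        unfolding weight_scalar_def weight_matrix_eq
        by (intro matrix_mult.continuous_on bounded_linear.continuous_on[OF bounded_linear_transpose]
            continuous_intros cont) (auto simp: power2_eq_1_iff)
      from bounded_linear.continuous_on[OF lin this]
      show "continuous_on (cbox (- 1 / 2) (1 / 2)) q"
        by (simp add: q_def[abs_def] weight_eq matrix_mult.scaleR_left matrix_mult.scaleR_right)
      have sub: "q integrable_on {-1/2..1/2}"
        using q(1) by (rule integrable_on_subinterval) auto
      have "integral {-1/2..1/2} q \<le> integral {-1..1} q"
        using sub q(1) q_nonneg by (intro integral_subset_le) auto
      moreover have "0 \<le> integral {-1/2..1/2} q"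
        using sub q_nonneg by (intro integral_nonneg) auto
      ultimately show "(q has_integral 0) (cbox (- 1 / 2) (1 / 2))"
        using sub that by (simp add: has_integral_iff)
    qed (use z q_nonneg in auto)
    moreover have "0 \<le> integral {-1..1} q"
      using q(1) q_nonneg by (intro integral_nonneg) auto
    ultimately show ?thesis using q(2) by (metis less_irrefl order_le_less)
  qed
  with sym show ?thesis by (simp add: positive_definite_def)
qed

section \<open>The differential operator is symmetric for the weight\<close>

text \<open>These are the symmetry equations of an operator \<open>F\<^sub>2, F\<^sub>1, F\<^sub>0\<close> with scalar \<open>F\<^sub>2 = q\<close>,
  divided by the scalar part \<open>\<rho> = (1 - x\<^sup>2)\<^bsup>n/2 - 1\<^esup>\<close> of the weight \<open>W = \<rho> T\<close>. Here \<open>c\<close> is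
  \<open>(q \<rho>)' / \<rho>\<close>, so the first two equations say that \<open>F\<^sub>1 W\<close> and its transpose \<open>W F\<^sub>1\<^sup>*\<close> are
  \<open>(F\<^sub>2 W)' + q \<rho> E\<close> and \<open>(F\<^sub>2 W)' - q \<rho> E\<close> for a constant antisymmetric matrix \<open>E\<close>, and the third that
  \<open>F\<^sub>0 W - W F\<^sub>0\<^sup>* = (q \<rho> E)'\<close>.\<close>

lemma symmetry_equations:
  fixes n p \<alpha> x :: real
  defines "q \<equiv> (x\<^sup>2 - 1) * (x - \<alpha>)" and "c \<equiv> n * x * (x - \<alpha>) + x\<^sup>2 - 1"
    and "T \<equiv> weight_matrix p n x" and "T' \<equiv> (2 * x) *\<^sub>R matrix2 p 0 0 (n - p) + matrix2 0 (- n) (- n) 0"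
    and "E \<equiv> (n - 2 * p) *\<^sub>R matrix2 0 1 (- 1) 0"
  shows "D_coeff1 n \<alpha> x ** T = c *\<^sub>R T + q *\<^sub>R T' + q *\<^sub>R E"
    and "T ** transpose (D_coeff1 n \<alpha> x) = c *\<^sub>R T + q *\<^sub>R T' - q *\<^sub>R E"
    and "D_coeff0 p n \<alpha> N x ** T = T ** transpose (D_coeff0 p n \<alpha> N x) + c *\<^sub>R E"
  unfolding assms
  by (simp_all add: D_coeff1_def D_coeff0_def mat2_eq_iff weight_matrix_def algebra_simps power2_eq_square)

text \<open>By the symmetry equations \<open>(f D) W g\<^sup>* - f W (g D)\<^sup>*\<close> is the derivative of
  \<open>q \<rho> (f' T g\<^sup>* - f T g'\<^sup>* + f E g\<^sup>*)\<close>. Its factor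
  \<open>-q \<rho> = (x - \<alpha>) (1 - x\<^sup>2)\<^bsup>n/2\<^esup>\<close> is continuous, since \<open>n > 0\<close>, and vanishes at
  \<open>-1\<close>, \<open>\<alpha>\<close> and \<open>1\<close>; so the operator is symmetric over \<open>[-1, \<alpha>]\<close> and over \<open>[-1, 1]\<close> alike.\<close>

lemma D_expr_symmetric:
  assumes n: "0 < n" and \<alpha>: "-1 < \<alpha>" "\<alpha> < 1" and \<beta>: "\<beta> = \<alpha> \<or> \<beta> = 1"
    and f: "\<And>x. x \<in> {-1..\<beta>} \<Longrightarrow> (f has_vector_derivative f' x) (at x within {-1..\<beta>})"
      "\<And>x. x \<in> {-1..\<beta>} \<Longrightarrow> (f' has_vector_derivative f'' x) (at x within {-1..\<beta>})"
      "continuous_on {-1..\<beta>} f''"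
    and g: "\<And>x. x \<in> {-1..\<beta>} \<Longrightarrow> (g has_vector_derivative g' x) (at x within {-1..\<beta>})"
      "\<And>x. x \<in> {-1..\<beta>} \<Longrightarrow> (g' has_vector_derivative g'' x) (at x within {-1..\<beta>})"
      "continuous_on {-1..\<beta>} g''"
  shows "pairing p n \<beta> (D_expr p n \<alpha> N f f' f'') g = pairing p n \<beta> f (D_expr p n \<alpha> N g g' g'')"
proof -
  have \<beta>1: "-1 \<le> \<beta>" "\<beta> \<le> 1" using \<alpha> \<beta> by auto
  define T where "T = weight_matrix p n"
  define T' where "T' x = (2 * x) *\<^sub>R matrix2 p 0 0 (n - p) + matrix2 0 (- n) (- n) 0" for x
  define E where "E = (n - 2 * p) *\<^sub>R matrix2 0 1 (- 1) 0"
  define u where "u x = (x - \<alpha>) * (1 - x\<^sup>2) powr (n / 2)" for x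
  define G where "G x = f' x ** T x ** transpose (g x) - f x ** T x ** transpose (g' x)
                        + f x ** E ** transpose (g x)" for x
  define G' where "G' x = f'' x ** T x ** transpose (g x) + f' x ** T' x ** transpose (g x)
      - f x ** T' x ** transpose (g' x) - f x ** T x ** transpose (g'' x)
      + f' x ** E ** transpose (g x) + f x ** E ** transpose (g' x)" for x
  define c where "c x = n * x * (x - \<alpha>) + x\<^sup>2 - 1" for x
  let ?L = "\<lambda>x. D_expr p n \<alpha> N f f' f'' x ** weight p n x ** transpose (g x)"
  let ?R = "\<lambda>x. f x ** weight p n x ** transpose (D_expr p n \<alpha> N g g' g'' x)"
  have cont: "continuous_on {-1..\<beta>} f" "continuous_on {-1..\<beta>} f'"
    "continuous_on {-1..\<beta>} g" "continuous_on {-1..\<beta>} g'"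
    by (rule continuous_on_vector_derivative, erule f(1,2) g(1,2))+
  have contD: "continuous_on {-1..\<beta>} (D_expr p n \<alpha> N f f' f'')"
    "continuous_on {-1..\<beta>} (D_expr p n \<alpha> N g g' g'')"
    by (intro continuous_on_D_expr cont f(3) g(3))+
  have contT: "continuous_on A T" for A
    unfolding T_def weight_matrix_eq by (intro continuous_intros)
  have "continuous_on {-1..\<beta>} G"
    unfolding G_def
    by (intro matrix_mult.continuous_on bounded_linear.continuous_on[OF bounded_linear_transpose]
        continuous_intros cont contT)
  moreover have "continuous_on {-1..\<beta>} u"
    unfolding u_def using n \<beta>1
    by (intro continuous_intros continuous_on_powr') (auto simp: abs_square_le_1 abs_le_iff)
  ultimately have contGu: "continuous_on {-1..\<beta>} (\<lambda>x. - (u x *\<^sub>R G x))"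
    by (intro continuous_intros)
  have deriv: "((\<lambda>x. - (u x *\<^sub>R G x)) has_vector_derivative ?L x - ?R x) (at x)"
    if x: "x \<in> {-1<..<\<beta>}" for x
  proof -
    have x1: "x\<^sup>2 < 1" using x \<beta>1 by (simp add: abs_square_less_1 abs_less_iff)
    have at: "at x within {-1..\<beta>} = at x"
      using x by (intro at_within_interior) auto
    have xin: "x \<in> {-1..\<beta>}" using x by simp
    note df = f(1)[OF xin, unfolded at] f(2)[OF xin, unfolded at]
      and dg = g(1)[OF xin, unfolded at] g(2)[OF xin, unfolded at]
    have dT: "(T has_vector_derivative T' x) (at x)"
      unfolding T_def T'_def weight_matrix_eq
      by (auto intro!: derivative_eq_intros)
    have dtr: "((\<lambda>x. transpose (h x)) has_vector_derivative transpose h') (at x)"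
      if "(h has_vector_derivative h') (at x)" for h :: "real \<Rightarrow> mat2" and h'
      using bounded_linear.has_vector_derivative[OF bounded_linear_transpose that] .
    have powr_half: "(1 - x\<^sup>2) powr (n / 2) = (1 - x\<^sup>2) * weight_scalar n x"
      using x1 by (simp add: powr_diff weight_scalar_def)
    have du: "(u has_real_derivative - c x * weight_scalar n x) (at x)"
    proof -
      have "(u has_real_derivative (1 - x\<^sup>2) powr (n / 2)
          + (x - \<alpha>) * (n / 2 * (1 - x\<^sup>2) powr (n / 2 - 1) * (- 2 * x))) (at x)"
        unfolding u_def using x1
        by (auto intro!: derivative_eq_intros)
      then show ?thesis
        unfolding powr_half by (simp add: weight_scalar_def c_def algebra_simps)
    qed
    have dG: "(G has_vector_derivative G' x) (at x)"
      unfolding G_def[abs_def]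
      by (rule has_vector_derivative_eq_rhs,
          (rule has_vector_derivative_add has_vector_derivative_diff
            matrix_mult.has_vector_derivative has_vector_derivative_const dtr df dg dT)+)
        (simp add: G'_def matrix_mult.add_left matrix_mult.add_right matrix_mul_assoc)
    have "((\<lambda>x. - (u x *\<^sub>R G x)) has_vector_derivative
        - (u x *\<^sub>R G' x + (- c x * weight_scalar n x) *\<^sub>R G x)) (at x)"
      by (intro has_vector_derivative_minus has_vector_derivative_scaleR du dG)
    also have "- (u x *\<^sub>R G' x + (- c x * weight_scalar n x) *\<^sub>R G x) = ?L x - ?R x"
    proof -
      define q where "q = (x\<^sup>2 - 1) * (x - \<alpha>)"
      note eqs = symmetry_equations[where n = n and p = p and \<alpha> = \<alpha> and x = x,
          folded q_def c_def T_def T'_def E_def]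
      let ?g = "transpose (g x)" and ?g' = "transpose (g' x)" and ?g'' = "transpose (g'' x)"
      have L: "?L x = weight_scalar n x *\<^sub>R
          (q *\<^sub>R (f'' x ** T x ** ?g) + f' x ** (D_coeff1 n \<alpha> x ** T x) ** ?g
            + f x ** (D_coeff0 p n \<alpha> N x ** T x) ** ?g)"
        unfolding D_expr_def weight_eq q_def[symmetric] mat_eq_scaleR[of q] T_def[symmetric]
        by (simp add: matrix_mult.add_left matrix_mult.scaleR_left matrix_mult.scaleR_right
            matrix_mul_assoc)
      have R: "?R x = weight_scalar n x *\<^sub>R
          (q *\<^sub>R (f x ** T x ** ?g'') + f x ** (T x ** transpose (D_coeff1 n \<alpha> x)) ** ?g'
            + f x ** (T x ** transpose (D_coeff0 p n \<alpha> N x)) ** ?g)"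
        unfolding D_expr_def weight_eq q_def[symmetric] mat_eq_scaleR[of q] T_def[symmetric]
        by (simp add: matrix_mult.add_right matrix_mult.scaleR_left matrix_mult.scaleR_right
            matrix_mul_assoc transpose_add transpose_scaleR matrix_transpose_mul
            scaleR_add_right mult.commute)
      have u: "u x = - q * weight_scalar n x"
        unfolding u_def powr_half by (simp add: q_def algebra_simps)
      show ?thesis
        unfolding L R eqs u G_def G'_def
        by (simp add: matrix_mult.add_left matrix_mult.add_right matrix_mult.diff_left
            matrix_mult.diff_right matrix_mult.scaleR_left matrix_mult.scaleR_right algebra_simps)
    qed
    finally show ?thesis .
  qed
  \<comment> \<open>At \<open>-1\<close> and \<open>1\<close> the integrand may be singular, so the derivative is used on the open
    interval only.\<close>
  have "((\<lambda>x. ?L x - ?R x) has_integral (- (u \<beta> *\<^sub>R G \<beta>) - - (u (-1) *\<^sub>R G (-1)))) {-1..\<beta>}"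
    by (rule fundamental_theorem_of_calculus_interior[OF \<beta>1(1) contGu deriv])
  moreover have "u \<beta> = 0" "u (-1) = 0" using \<beta> by (auto simp: u_def)
  ultimately have "integral {-1..\<beta>} (\<lambda>x. ?L x - ?R x) = 0"
    by (simp add: integral_unique)
  moreover have "integral {-1..\<beta>} (\<lambda>x. ?L x - ?R x) = integral {-1..\<beta>} ?L - integral {-1..\<beta>} ?R"
    using n \<beta>1 cont contD by (intro integral_diff pairing_integrable)
  ultimately show ?thesis by (simp add: pairing_def)
qed

section \<open>Derivatives on an interval\<close>

lemma deriv_on_eq:
  assumes "a < b" "x \<in> {a..b}" "(f has_vector_derivative f') (at x within {a..b})"
  shows "deriv_on a b f x = f'"
  unfolding deriv_on_def using assms by (intro vector_derivative_within_closed_interval) auto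

lemma D_tilde_eq_D_expr:
  assumes \<alpha>: "-1 < \<alpha>" and x: "x \<in> {-1..\<alpha>}"
    and f: "\<And>x. x \<in> {-1..\<alpha>} \<Longrightarrow> (f has_vector_derivative f' x) (at x within {-1..\<alpha>})"
    and f': "\<And>x. x \<in> {-1..\<alpha>} \<Longrightarrow> (f' has_vector_derivative f'' x) (at x within {-1..\<alpha>})"
  shows "D_tilde p n \<alpha> N f x = D_expr p n \<alpha> N f f' f'' x"
proof -
  have 1: "deriv_on (-1) \<alpha> f y = f' y" if "y \<in> {-1..\<alpha>}" for y
    using deriv_on_eq[OF \<alpha> that f[OF that]] .
  have "(deriv_on (-1) \<alpha> f has_vector_derivative f'' x) (at x within {-1..\<alpha>})"
    by (rule has_vector_derivative_transform[OF x _ f'[OF x]]) (simp add: 1)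
  from deriv_on_eq[OF \<alpha> x this] 1[OF x] show ?thesis
    by (simp add: D_tilde_eq D_expr_def)
qed

lemma smooth_on_interval_derivatives:
  assumes "smooth_on_interval a b f"
  obtains f' f'' where
    "\<And>x. x \<in> {a..b} \<Longrightarrow> (f has_vector_derivative f' x) (at x within {a..b})"
    "\<And>x. x \<in> {a..b} \<Longrightarrow> (f' has_vector_derivative f'' x) (at x within {a..b})"
    "continuous_on {a..b} f''"
proof
  let ?d = "\<lambda>k. (deriv_on a b ^^ k) f"
  have diff: "?d k differentiable_on {a..b}" for k
    using assms by (simp add: smooth_on_interval_def)
  have step: "(?d k has_vector_derivative ?d (Suc k) x) (at x within {a..b})" if "x \<in> {a..b}" for k x
    using diff[of k] that
    by (simp add: differentiable_on_def deriv_on_def vector_derivative_works[symmetric])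
  show "(f has_vector_derivative ?d 1 x) (at x within {a..b})" if "x \<in> {a..b}" for x
    using step[OF that, of 0] by simp
  show "(?d 1 has_vector_derivative ?d 2 x) (at x within {a..b})" if "x \<in> {a..b}" for x
    using step[OF that, of 1] by (simp add: numeral_2_eq_2)
  show "continuous_on {a..b} (?d 2)"
    using differentiable_imp_continuous_on[OF diff] .
qed

section \<open>The integral operator is an orthogonal projection after truncation\<close>

locale monic_orthogonal_system =
  fixes p n :: real and R :: "nat \<Rightarrow> real \<Rightarrow> mat2"
  assumes p: "0 < p" and pn: "p < n" and orth: "monic_orthogonal_polys (weight p n) R"
begin

abbreviation "Q \<equiv> orthonormal_polys (weight p n) R"
abbreviation "H w \<equiv> sq_norm (weight p n) (R w)"

definition inv_norm :: "nat \<Rightarrow> mat2" where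
  "inv_norm w = transpose (matrix_inv (pd_sqrt (H w))) ** matrix_inv (pd_sqrt (H w))"

lemma n_pos: "0 < n" using p pn by simp

lemma monic: "monic_matrix_poly w (R w)"
  using orth by (simp add: monic_orthogonal_polys_def)

lemma inv_norm_left: "inv_norm w ** H w = mat 1"
  unfolding inv_norm_def by (intro inverse_pd_sqrt sq_norm_positive_definite[OF p pn monic])

lemma inv_norm_right: "H w ** inv_norm w = mat 1"
  using inv_norm_left by (simp add: matrix_left_right_inverse)

lemma R_in_polys: "w \<le> N \<Longrightarrow> R w \<in> matrix_polys N"
  using monic_matrix_poly_in_polys[OF monic] by (rule matrix_polys_mono)

lemma continuous_on_R: "continuous_on A (R w)"
  by (rule continuous_on_matrix_polys[OF R_in_polys[OF order_refl]])

lemma pairing_R: "pairing p n 1 (R w) (R v) = (if w = v then H w else 0)"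
  using orth by (auto simp: monic_orthogonal_polys_def pairing_def sq_norm_def integral_unique)

lemma pairing_expansion:
  assumes "v \<le> N"
  shows "pairing p n 1 (\<lambda>x. \<Sum>w\<le>N. A w ** R w x) (R v) = A v ** H v"
proof -
  have "pairing p n 1 (\<lambda>x. \<Sum>w\<le>N. A w ** R w x) (R v) = (\<Sum>w\<le>N. A w ** pairing p n 1 (R w) (R v))"
    using n_pos
    by (simp add: pairing_sum_left pairing_lmult continuous_on_R matrix_mult.continuous_on)
  also have "\<dots> = A v ** H v"
    using assms by (simp add: pairing_R if_distrib[where f = "\<lambda>M. _ ** M"] cong: if_cong)
  finally show ?thesis .
qed

text \<open>The coefficients of a polynomial in the basis \<open>R\<^sub>w\<close> can be read off from its pairings with the
  \<open>R\<^sub>v\<close>, because the norms \<open>H v\<close> are invertible.\<close>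

lemma polys_determined:
  assumes P: "P \<in> matrix_polys N" and zero: "\<And>v. v \<le> N \<Longrightarrow> pairing p n 1 P (R v) = 0"
  shows "P x = 0"
proof -
  obtain A where A: "\<forall>x. P x = (\<Sum>w\<le>N. A w ** R w x)"
    using expansion_in_monic_polys[OF monic P] by blast
  then have P_eq: "P = (\<lambda>x. \<Sum>w\<le>N. A w ** R w x)" by auto
  have "A v = 0" if "v \<le> N" for v
  proof -
    have "A v ** H v = 0"
      using zero[OF that] pairing_expansion[OF that] by (simp add: P_eq)
    then have "A v ** (H v ** inv_norm v) = 0"
      by (simp add: matrix_mul_assoc)
    then show ?thesis by (simp add: inv_norm_right)
  qed
  then show ?thesis by (simp add: P_eq)
qed

lemma integral_op_expansion:
  assumes \<alpha>: "\<alpha> \<le> 1" and f: "continuous_on {-1..\<alpha>} f"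
  shows "integral_op (weight p n) Q \<alpha> N f
           = (\<lambda>x. \<Sum>w\<le>N. (pairing p n \<alpha> f (R w) ** inv_norm w) ** R w x)"
proof
  fix x
  let ?F = "\<lambda>w y. f y ** weight p n y ** transpose (R w y)"
  have int: "?F w integrable_on {-1..\<alpha>}" for w
    by (intro pairing_integrable n_pos \<alpha> f continuous_on_R)
  have summand: "((\<lambda>y. ?F w y ** (inv_norm w ** R w x)) has_integral
      pairing p n \<alpha> f (R w) ** (inv_norm w ** R w x)) {-1..\<alpha>}" for w
    using has_integral_linear[OF integrable_integral[OF int] matrix_mult.bounded_linear_left]
    by (simp add: o_def pairing_def)
  have "f y ** weight p n y ** transpose (kernel Q N x y) = (\<Sum>w\<le>N. ?F w y ** (inv_norm w ** R w x))" for y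
    by (simp add: kernel_def orthonormal_polys_def inv_norm_def transpose_sum matrix_transpose_mul
        matrix_mult.sum_right matrix_mul_assoc)
  then have "integral_op (weight p n) Q \<alpha> N f x
      = integral {-1..\<alpha>} (\<lambda>y. \<Sum>w\<le>N. ?F w y ** (inv_norm w ** R w x))"
    by (simp add: integral_op_def)
  also have "\<dots> = (\<Sum>w\<le>N. pairing p n \<alpha> f (R w) ** (inv_norm w ** R w x))"
    by (intro integral_unique has_integral_sum summand) auto
  finally show "integral_op (weight p n) Q \<alpha> N f x
      = (\<Sum>w\<le>N. (pairing p n \<alpha> f (R w) ** inv_norm w) ** R w x)"
    by (simp add: matrix_mul_assoc)
qed

lemma integral_op_in_polys:
  assumes "\<alpha> \<le> 1" "continuous_on {-1..\<alpha>} f"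
  shows "integral_op (weight p n) Q \<alpha> N f \<in> matrix_polys N"
  unfolding integral_op_expansion[OF assms]
  by (intro matrix_polys_sum matrix_polys_lmult R_in_polys) simp

text \<open>This property, together with membership in \<open>matrix_polys N\<close>, characterises \<open>f S\<close>: it is the
  orthogonal projection over \<open>[-1, 1]\<close> of the function that equals \<open>f\<close> on \<open>[-1, \<alpha>]\<close> and vanishes
  beyond \<open>\<alpha>\<close>.\<close>

lemma integral_op_projection:
  assumes \<alpha>: "\<alpha> \<le> 1" and f: "continuous_on {-1..\<alpha>} f" and P: "P \<in> matrix_polys N"
  shows "pairing p n 1 (integral_op (weight p n) Q \<alpha> N f) P = pairing p n \<alpha> f P"
proof -
  let ?S = "integral_op (weight p n) Q \<alpha> N f"
  have R: "pairing p n 1 ?S (R v) = pairing p n \<alpha> f (R v)" if "v \<le> N" for v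
    unfolding integral_op_expansion[OF \<alpha> f] pairing_expansion[OF that]
    by (simp add: matrix_mul_assoc[symmetric] inv_norm_left)
  obtain A where "\<forall>x. P x = (\<Sum>w\<le>N. A w ** R w x)"
    using expansion_in_monic_polys[OF monic P] by blast
  then have P_eq: "P = (\<lambda>x. \<Sum>w\<le>N. A w ** R w x)" by auto
  have expand: "pairing p n \<beta> g P = (\<Sum>w\<le>N. pairing p n \<beta> g (R w) ** transpose (A w))"
    if "\<beta> \<le> 1" "continuous_on {-1..\<beta>} g" for \<beta> g
    using that n_pos
    by (simp add: P_eq pairing_sum_right pairing_rmult continuous_on_R matrix_mult.continuous_on)
  show ?thesis
    using \<alpha> f R continuous_on_matrix_polys[OF integral_op_in_polys[OF \<alpha> f]]
    by (simp add: expand)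
qed

text \<open>Both sides are polynomials of degree at most \<open>N\<close>, so it suffices to compare their pairings over
  \<open>[-1, 1]\<close> with each \<open>R\<^sub>v\<close>. Each of the equations
  \<open>\<langle>(f D) S, R\<^sub>v\<rangle> = \<langle>f D, R\<^sub>v\<rangle>\<^sub>\<alpha> = \<langle>f, R\<^sub>v D\<rangle>\<^sub>\<alpha> = \<langle>f S, R\<^sub>v D\<rangle> = \<langle>(f S) D, R\<^sub>v\<rangle>\<close>
  is the projection property or the symmetry of \<open>D\<close>; the third one needs that \<open>R\<^sub>v D\<close> again has
  degree at most \<open>N\<close>.\<close>

lemma integral_op_commutes_D_tilde:
  fixes N :: nat
  assumes \<alpha>: "-1 < \<alpha>" "\<alpha> < 1" and f: "smooth_on_interval (-1) \<alpha> f" and x: "x \<in> {-1..\<alpha>}"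
  defines "S \<equiv> integral_op (weight p n) Q \<alpha> N" and "D \<equiv> D_tilde p n \<alpha> N"
  shows "S (D f) x = D (S f) x"
proof -
  have \<alpha>1: "\<alpha> \<le> 1" using \<alpha> by simp
  obtain f' f'' where f':
    "\<And>x. x \<in> {-1..\<alpha>} \<Longrightarrow> (f has_vector_derivative f' x) (at x within {-1..\<alpha>})"
    "\<And>x. x \<in> {-1..\<alpha>} \<Longrightarrow> (f' has_vector_derivative f'' x) (at x within {-1..\<alpha>})"
    "continuous_on {-1..\<alpha>} f''"
    using smooth_on_interval_derivatives[OF f] by blast
  have contf: "continuous_on {-1..\<alpha>} f" "continuous_on {-1..\<alpha>} f'"
    by (rule continuous_on_vector_derivative, erule f'(1,2))+
  let ?Df = "D_expr p n \<alpha> N f f' f''"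
  have contDf: "continuous_on {-1..\<alpha>} ?Df"
    by (intro continuous_on_D_expr contf f'(3))
  have "D f y = ?Df y" if "y \<in> {-1..\<alpha>}" for y
    unfolding D_def by (rule D_tilde_eq_D_expr[OF \<alpha>(1) that]) (fact f')+
  then have SDf: "S (D f) = S ?Df"
    unfolding S_def integral_op_def by (intro ext integral_cong) simp
  have Sf: "S f \<in> matrix_polys N" and SDf_poly: "S ?Df \<in> matrix_polys N"
    unfolding S_def by (intro integral_op_in_polys \<alpha>1 contf contDf)+
  obtain g' g'' where g:
    "\<And>x. (S f has_vector_derivative g' x) (at x)" "\<And>x. (g' has_vector_derivative g'' x) (at x)"
    "\<And>A. continuous_on A g''" "D_expr p n \<alpha> N (S f) g' g'' \<in> matrix_polys N"
    using D_expr_polys[OF Sf] by metis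
  let ?DSf = "D_expr p n \<alpha> N (S f) g' g''"
  have "pairing p n 1 (\<lambda>x. S ?Df x - ?DSf x) (R v) = 0" if v: "v \<le> N" for v
  proof -
    obtain h' h'' where h:
      "\<And>x. (R v has_vector_derivative h' x) (at x)" "\<And>x. (h' has_vector_derivative h'' x) (at x)"
      "\<And>A. continuous_on A h''" "D_expr p n \<alpha> N (R v) h' h'' \<in> matrix_polys N"
      using D_expr_polys[OF R_in_polys[OF v]] by metis
    let ?DR = "D_expr p n \<alpha> N (R v) h' h''"
    have "pairing p n 1 (S ?Df) (R v) = pairing p n \<alpha> ?Df (R v)"
      unfolding S_def by (intro integral_op_projection \<alpha>1 contDf R_in_polys v)
    also have "\<dots> = pairing p n \<alpha> f ?DR"
      by (intro D_expr_symmetric n_pos \<alpha> f' h(3)) (auto intro: h has_vector_derivative_at_within)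
    also have "\<dots> = pairing p n 1 (S f) ?DR"
      unfolding S_def by (intro integral_op_projection[symmetric] \<alpha>1 contf h)
    also have "\<dots> = pairing p n 1 ?DSf (R v)"
      by (intro D_expr_symmetric[symmetric] n_pos \<alpha> g(3) h(3))
        (auto intro: g h has_vector_derivative_at_within)
    finally show ?thesis
      using n_pos
      by (simp add: pairing_diff_left continuous_on_R continuous_on_matrix_polys[OF SDf_poly]
          continuous_on_matrix_polys[OF g(4)])
  qed
  from polys_determined[OF matrix_polys_diff[OF SDf_poly g(4)] this]
  have "S (D f) x = ?DSf x" by (simp add: SDf)
  also have "\<dots> = D (S f) x"
    unfolding D_def
    by (rule D_tilde_eq_D_expr[symmetric, OF \<alpha>(1) x]) (auto intro: g has_vector_derivative_at_within)
  finally show ?thesis .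
qed

end

theorem corollary3p5:
  fixes n p \<alpha> :: real and N :: nat
    and R :: "nat \<Rightarrow> real \<Rightarrow> real^2^2" and f :: "real \<Rightarrow> real^2^2"
  defines "W \<equiv> weight p n"
  defines "Q \<equiv> orthonormal_polys W R"
  defines "S \<equiv> integral_op W Q \<alpha> N"
  defines "D \<equiv> D_tilde p n \<alpha> N"
  assumes "0 < p" and "p < n"
    and "-1 < \<alpha>" and "\<alpha> < 1"
    and "monic_orthogonal_polys W R"
    and "smooth_on_interval (-1) \<alpha> f"
  shows "\<forall>x\<in>{-1..\<alpha>}. S (D f) x = D (S f) x"
proof -
  interpret monic_orthogonal_system p n R
    using assms by unfold_locales (simp_all add: W_def)
  show ?thesis
    using integral_op_commutes_D_tilde assms by (simp add: W_def Q_def S_def D_def)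
qed

end
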